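(* The Cauchy completion of a homogeneous ultrametric space is homogeneous.
   Context: A metric space $(M,d)$ is ultrametric if $d(x,z)\le\max\{d(x,y),d(y,z)\}$ for all $x,y,z$. A metric space $\mathbf{M}$ is homogeneous if every isometry from a finite subset of $M$ onto a finite subset of $M$ extends to a surjective isometry of $\mathbf{M}$ onto $\mathbf{M}$. The Cauchy completion is the usual metric completion. *)

theory Defs
  imports "HOL-Analysis.Analysis"
begin

definition ultrametric :: "'a metric \<Rightarrow> bool" where
  "ultrametric m \<longleftrightarrow>
     (\<forall>x\<in>mspace m. \<forall>y\<in>mspace m. \<forall>z\<in>mspace m.
        mdist m x z \<le> max (mdist m x y) (mdist m y z))"

definition isometry_onto :: "'a metric \<Rightarrow> 'b metric \<Rightarrow> ('a \<Rightarrow> 'b) \<Rightarrow> bool" where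
  "isometry_onto m1 m2 f \<longleftrightarrow>
     f ` mspace m1 = mspace m2 \<and>
     (\<forall>x\<in>mspace m1. \<forall>y\<in>mspace m1. mdist m2 (f x) (f y) = mdist m1 x y)"

definition homogeneous :: "'a metric \<Rightarrow> bool" where
  "homogeneous m \<longleftrightarrow>
     (\<forall>A B f. finite A \<and> A \<subseteq> mspace m \<and> finite B \<and> B \<subseteq> mspace m \<and>
              isometry_onto (submetric m A) (submetric m B) f \<longrightarrow>
        (\<exists>g. isometry_onto m m g \<and> (\<forall>x\<in>A. g x = f x)))"

text \<open>
  A completion of \<open>m\<close> is a complete space \<open>m'\<close> together with an isometric embedding
  \<open>\<iota>\<close> of \<open>m\<close> onto a dense subset of \<open>m'\<close>; it is unique up to isometry.  The points
  of \<open>m'\<close> may have any type, so this covers every concrete construction, such as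
  classes of Cauchy sequences.
\<close>

definition is_completion :: "'a metric \<Rightarrow> ('a \<Rightarrow> 'b) \<Rightarrow> 'b metric \<Rightarrow> bool" where
  "is_completion m \<iota> m' \<longleftrightarrow>
     mcomplete_of m' \<and>
     \<iota> \<in> mspace m \<rightarrow> mspace m' \<and>
     (\<forall>x\<in>mspace m. \<forall>y\<in>mspace m. mdist m' (\<iota> x) (\<iota> y) = mdist m x y) \<and>
     mtopology_of m' closure_of (\<iota> ` mspace m) = mspace m'"

lemma completion_exists:
  fixes m :: "'a metric"
  shows "\<exists>(\<iota> :: 'a \<Rightarrow> 'a \<Rightarrow> real) m'. is_completion m \<iota> m'"
proof -
  interpret Metric_space "mspace m" "mdist m"
    by simp
  obtain f :: "'a \<Rightarrow> 'a \<Rightarrow> real" and m' where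
    "mcomplete_of m'" "f \<in> mspace m \<rightarrow> mspace m'"
    "mtopology_of m' closure_of f ` mspace m = mspace m'"
    "\<And>x y. \<lbrakk>x \<in> mspace m; y \<in> mspace m\<rbrakk> \<Longrightarrow> mdist m' (f x) (f y) = mdist m x y"
    using metric_completion by metis
  then have "is_completion m f m'"
    by (simp add: is_completion_def)
  then show ?thesis
    by blast
qed

end

theory Submission
  imports Defs
begin

text \<open>
  Perturbing the points of a finite subset of the completion by less than all their mutual
  distances does not change these distances, so homogeneity of \<open>m\<close> yields, for every \<open>e > 0\<close>, a
  surjective isometry of \<open>m'\<close> that agrees with a given finite partial isometry \<open>f\<close> on \<open>A\<close> up to
  an error less than \<open>e\<close>. An exact extension is glued from these without any limit process: on
  the set of points at distance \<open>r > 0\<close> from \<open>A\<close>, use an isometry whose error is less than \<open>r\<close>.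
  Such an error is invisible from there, and two points at different distances
  from \<open>A\<close> have a mutual distance that is determined by their distances to \<open>A\<close>.
\<close>

section \<open>Ultrametric triangles and isometries of subspaces\<close>

lemma mdist_refl:
  "x \<in> mspace m \<Longrightarrow> mdist m x x = 0"
  using mdist_zero by metis

lemma ultrametricD:
  assumes "ultrametric m" "x \<in> mspace m" "y \<in> mspace m" "z \<in> mspace m"
  shows "mdist m x z \<le> max (mdist m x y) (mdist m y z)"
  using assms unfolding ultrametric_def by blast

text \<open>The strong triangle inequality bounds \<open>mdist m x z\<close> by
  \<open>mdist m y z\<close>. With \<open>x\<close> and \<open>y\<close> swapped it bounds
  \<open>mdist m y z\<close> by the maximum of the other two sides, which cannot be the short side
  \<open>mdist m x y\<close>.\<close>

lemma ultrametric_isosceles: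
  assumes "ultrametric m" "x \<in> mspace m" "y \<in> mspace m" "z \<in> mspace m"
    and "mdist m x y < mdist m y z"
  shows "mdist m x z = mdist m y z"
  using ultrametricD[of m x y z] ultrametricD[of m y x z] assms mdist_commute[of m x y]
  by linarith

lemma isometry_onto_mdist:
  assumes "isometry_onto m1 m2 f" "x \<in> mspace m1" "y \<in> mspace m1"
  shows "mdist m2 (f x) (f y) = mdist m1 x y"
  using assms unfolding isometry_onto_def by blast

lemma isometry_onto_mspace:
  assumes "isometry_onto m1 m2 f" "x \<in> mspace m1"
  shows "f x \<in> mspace m2"
  using assms unfolding isometry_onto_def by blast

lemma isometry_onto_image:
  assumes "isometry_onto m1 m2 f"
  shows "f ` mspace m1 = mspace m2"
  using assms unfolding isometry_onto_def by blast

lemma isometry_onto_submetric: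
  assumes "A \<subseteq> mspace m" "B \<subseteq> mspace m"
  shows "isometry_onto (submetric m A) (submetric m B) f \<longleftrightarrow>
    f ` A = B \<and> (\<forall>x\<in>A. \<forall>y\<in>A. mdist m (f x) (f y) = mdist m x y)"
  using assms by (simp add: isometry_onto_def inf.absorb1)

section \<open>Gluing approximate extensions to an exact one\<close>

lemma ultrametric_isometry_of_approximations:
  assumes um: "ultrametric m" and "finite A" "A \<subseteq> mspace m" "f ` A \<subseteq> mspace m"
    and fiso: "\<And>a b. \<lbrakk>a \<in> A; b \<in> A\<rbrakk> \<Longrightarrow> mdist m (f a) (f b) = mdist m a b"
    and approx: "\<And>e. e > 0 \<Longrightarrow> \<exists>g. isometry_onto m m g \<and> (\<forall>a\<in>A. mdist m (g a) (f a) < e)"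
  shows "\<exists>g. isometry_onto m m g \<and> (\<forall>a\<in>A. g a = f a)"
proof (cases "A = {}")
  \<comment> \<open>Treated separately because the minimum in \<open>D\<close> below requires a
    nonempty \<open>A\<close>.\<close>
  case True
  have "isometry_onto m m id"
    by (simp add: isometry_onto_def)
  with True show ?thesis
    by blast
next
  case False
  obtain G where G: "\<And>e. e > 0 \<Longrightarrow> isometry_onto m m (G e)"
    and Gf: "\<And>e a. \<lbrakk>e > 0; a \<in> A\<rbrakk> \<Longrightarrow> mdist m (G e a) (f a) < e"
    using approx by metis
  have GM: "G e x \<in> mspace m" if "e > 0" "x \<in> mspace m" for e x
    using isometry_onto_mspace G that by metis
  have G_iso: "mdist m (G e x) (G e y) = mdist m x y"
    if "e > 0" "x \<in> mspace m" "y \<in> mspace m" for e x y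
    using isometry_onto_mdist G that by metis
  \<comment> \<open>\<open>D x\<close> is the distance from \<open>x\<close> to \<open>A\<close>. It
    vanishes on \<open>A\<close>, where no positive tolerance is available, so \<open>h\<close>
    takes the value of \<open>f\<close> there.\<close>
  define D where "D x = Min (mdist m x ` A)" for x
  define h where "h x = (if x \<in> A then f x else G (D x) x)" for x
  have AM: "a \<in> mspace m" and fM: "f a \<in> mspace m" if "a \<in> A" for a
    using that assms by auto
  have D_le: "D x \<le> mdist m x a" if "a \<in> A" for x a
    unfolding D_def using that assms by simp
  have D_ex: "\<exists>a\<in>A. D x = mdist m x a" for x
  proof -
    have "D x \<in> mdist m x ` A"
      unfolding D_def using False assms by (intro Min_in) auto
    then show ?thesis by auto
  qed
  have D_pos: "D x > 0" if "x \<in> mspace m" "x \<notin> A" for x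
    using D_ex[of x] that AM mdist_nonneg[of m x] mdist_zero[of x m]
    by (metis less_eq_real_def)
  have h_mspace: "h x \<in> mspace m" if "x \<in> mspace m" for x
    using that fM D_pos GM by (simp add: h_def)
  \<comment> \<open>In the triangle \<open>f a\<close>, \<open>G r a\<close>, \<open>G r x\<close>
    the first side is the error, hence shorter than \<open>r\<close>, while the side from
    \<open>G r a\<close> to \<open>G r x\<close> is at least \<open>r\<close>. So the error does not
    affect the third side.\<close>
  have G_f: "mdist m (G r x) (f a) = mdist m x a"
    if "x \<in> mspace m" "a \<in> A" "0 < r" "r \<le> mdist m x a" for x a r
  proof -
    have "mdist m (G r a) (G r x) = mdist m a x"
      using G_iso that AM by simp
    then have "mdist m (f a) (G r a) < mdist m (G r a) (G r x)"
      using Gf[of r a] that by (simp add: mdist_commute)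
    then have "mdist m (f a) (G r x) = mdist m (G r a) (G r x)"
      using um that AM fM GM by (intro ultrametric_isosceles) auto
    then show ?thesis
      using \<open>mdist m (G r a) (G r x) = mdist m a x\<close> by (simp add: mdist_commute)
  qed
  have h_f: "mdist m (h x) (f a) = mdist m x a" if "x \<in> mspace m" "a \<in> A" for x a
    using that fiso G_f D_pos D_le unfolding h_def by simp
  have D_less: "mdist m (h x) (h y) = mdist m x y"
    if "x \<in> mspace m" "y \<in> mspace m" "D x < D y" for x y
  proof -
    \<comment> \<open>For \<open>a\<close> nearest to \<open>x\<close>, the side from
      \<open>x\<close> to \<open>a\<close> is shorter than the one from \<open>a\<close> to
      \<open>y\<close>, so \<open>y\<close> is equally far from \<open>x\<close> and
      \<open>a\<close>. The same holds for \<open>h x\<close>, \<open>f a\<close>,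
      \<open>h y\<close>, since \<open>h_f\<close> keeps both sides.\<close>
    obtain a where a: "a \<in> A" "D x = mdist m x a"
      using D_ex by blast
    have less: "mdist m x a < mdist m a y"
      using a D_le[of a y] that by (simp add: mdist_commute)
    then have "mdist m x y = mdist m a y"
      using um that a AM by (intro ultrametric_isosceles) auto
    moreover have "mdist m (h x) (h y) = mdist m (f a) (h y)"
      using um that a less fM h_mspace h_f
      by (intro ultrametric_isosceles) (auto simp: mdist_commute)
    moreover have "mdist m (f a) (h y) = mdist m a y"
      using h_f that a by (simp add: mdist_commute)
    ultimately show ?thesis
      by simp
  qed
  have h_iso: "mdist m (h x) (h y) = mdist m x y" if "x \<in> mspace m" "y \<in> mspace m" for x y
  proof -
    consider "x \<in> A" | "y \<in> A" | "D x < D y" | "D y < D x" | "x \<notin> A" "y \<notin> A" "D x = D y"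
      by force
    then show ?thesis
    proof cases
      case 1
      then have "h x = f x" by (simp add: h_def)
      then show ?thesis using h_f[of y x] 1 that by (simp add: mdist_commute)
    next
      case 2
      then have "h y = f y" by (simp add: h_def)
      then show ?thesis using h_f[of x y] 2 that by simp
    next
      case 3
      then show ?thesis using D_less that by blast
    next
      case 4
      then show ?thesis using D_less[of y x] that by (simp add: mdist_commute)
    next
      \<comment> \<open>Equal distance to \<open>A\<close> means that one and the same isometry
        \<open>G (D x)\<close> moves both points.\<close>
      case 5
      then show ?thesis
        using G_iso D_pos that by (simp add: h_def)
    qed
  qed
  have h_surj: "y \<in> h ` mspace m" if y: "y \<in> mspace m" for y
  proof (cases "y \<in> f ` A")
    case True
    then show ?thesis using AM by (auto simp: h_def)
  next
    case False
    \<comment> \<open>The distance from \<open>y\<close> to the image of \<open>A\<close> is the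
      only possible value of \<open>D\<close> at a preimage of \<open>y\<close>, so the preimage is
      sought under \<open>G r\<close>. It remains to see that \<open>D x = r\<close>, which makes
      \<open>h\<close> use \<open>G r\<close> at \<open>x\<close>.\<close>
    define r where "r = Min (mdist m y ` f ` A)"
    have r_le: "r \<le> mdist m y (f a)" if "a \<in> A" for a
      unfolding r_def using that assms by simp
    have "r \<in> mdist m y ` f ` A"
      unfolding r_def using \<open>A \<noteq> {}\<close> assms by (intro Min_in) auto
    then obtain b where b: "b \<in> A" "r = mdist m y (f b)"
      by auto
    have "r > 0"
      using b fM y False mdist_nonneg[of m y "f b"] mdist_zero[of y m "f b"]
      by (metis image_eqI less_eq_real_def)
    obtain x where x: "x \<in> mspace m" "y = G r x"
      using isometry_onto_image[OF G[OF \<open>r > 0\<close>]] y by auto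
    have xa: "mdist m x a = mdist m y (f a)" if a: "a \<in> A" for a
    proof -
      have "mdist m (G r a) (f a) < mdist m (f a) y"
        using Gf[OF \<open>r > 0\<close> a] r_le[OF a] by (simp add: mdist_commute)
      then have "mdist m (G r a) y = mdist m (f a) y"
        using um a y AM fM GM \<open>r > 0\<close> by (intro ultrametric_isosceles) auto
      moreover have "mdist m (G r a) y = mdist m a x"
        using G_iso \<open>r > 0\<close> x a AM by simp
      ultimately show ?thesis
        by (simp add: mdist_commute)
    qed
    have "D x = r"
      unfolding D_def r_def image_image using xa by (intro arg_cong[where f = Min] image_cong) auto
    \<comment> \<open>Otherwise \<open>xa\<close> at \<open>x\<close> itself would put
      \<open>y\<close> at distance 0 from \<open>f x\<close>, against \<open>r > 0\<close>.\<close>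
    moreover have "x \<notin> A"
      using xa[of x] r_le[of x] \<open>r > 0\<close> x mdist_refl[of x m] by fastforce
    ultimately have "h x = y"
      using x by (simp add: h_def)
    then show ?thesis
      using x by blast
  qed
  have "isometry_onto m m h"
    unfolding isometry_onto_def using h_iso h_surj h_mspace by blast
  moreover have "\<forall>a\<in>A. h a = f a"
    by (simp add: h_def)
  ultimately show ?thesis
    by blast
qed

section \<open>Density, completeness and the passage to the completion\<close>

lemma is_completion_mspace:
  assumes "is_completion m \<iota> m'" "x \<in> mspace m"
  shows "\<iota> x \<in> mspace m'"
  using assms unfolding is_completion_def by blast

lemma is_completion_mdist:
  assumes "is_completion m \<iota> m'" "x \<in> mspace m" "y \<in> mspace m"
  shows "mdist m' (\<iota> x) (\<iota> y) = mdist m x y"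
  using assms unfolding is_completion_def by blast

lemma is_completion_dense:
  assumes "is_completion m \<iota> m'" "x \<in> mspace m'" "e > 0"
  shows "\<exists>z\<in>mspace m. mdist m' x (\<iota> z) < e"
proof -
  interpret Metric_space "mspace m'" "mdist m'"
    by simp
  have "x \<in> mtopology closure_of (\<iota> ` mspace m)"
    using assms unfolding is_completion_def mtopology_of_def by simp
  then show ?thesis
    using assms by (auto simp: metric_closure_of)
qed

text \<open>Moving only the first argument of each distance by less than \<open>e/2\<close> changes
  each distance by less than \<open>e/2\<close>, so the two differ by less than
  \<open>e\<close>.\<close>

lemma mdist_eq_by_approximation:
  assumes "x \<in> mspace m" "y \<in> mspace m" "x' \<in> mspace m" "y' \<in> mspace m"
    and "\<And>e. e > 0 \<Longrightarrow> \<exists>u\<in>mspace m. \<exists>u'\<in>mspace m. mdist m x u < e \<and>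
          mdist m x' u' < e \<and> mdist m u' y' = mdist m u y"
  shows "mdist m x' y' = mdist m x y"
proof -
  \<comment> \<open>The summand 0 gives the shape that \<open>field_le_epsilon\<close>
    expects.\<close>
  have "\<bar>mdist m x' y' - mdist m x y\<bar> \<le> 0 + e" if e: "e > 0" for e
  proof -
    obtain u u' where u: "u \<in> mspace m" "u' \<in> mspace m" "mdist m x u < e/2"
      "mdist m x' u' < e/2" "mdist m u' y' = mdist m u y"
      using assms(5)[OF half_gt_zero[OF e]] by metis
    then show ?thesis
      using mdist_triangle[of x m u y] mdist_triangle[of x' m u' y']
        mdist_triangle[of u m x y] mdist_triangle[of u' m x' y'] assms
        mdist_commute[of m x u] mdist_commute[of m x' u']
      by (simp add: abs_if)
  qed
  then have "\<bar>mdist m x' y' - mdist m x y\<bar> \<le> 0"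
    by (rule field_le_epsilon)
  then show ?thesis
    by simp
qed

text \<open>A sequence of points \<open>\<alpha> (k n)\<close> tending to \<open>x\<close> is
  Cauchy, hence so is \<open>\<beta> (k n)\<close>, and its limit is \<open>y\<close>. Indexing both
  families by \<open>I\<close> lets their roles be exchanged: one direction yields images under an
  extended isometry, the other preimages.\<close>

lemma mcomplete_transfer_point:
  assumes "mcomplete_of m" "\<alpha> ` I \<subseteq> mspace m" "\<beta> ` I \<subseteq> mspace m"
    and iso: "\<And>i j. \<lbrakk>i \<in> I; j \<in> I\<rbrakk> \<Longrightarrow> mdist m (\<beta> i) (\<beta> j) = mdist m (\<alpha> i) (\<alpha> j)"
    and x: "x \<in> mspace m"
    and dense: "\<And>e. e > 0 \<Longrightarrow> \<exists>i\<in>I. mdist m x (\<alpha> i) < e"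
  shows "\<exists>y\<in>mspace m. \<forall>i\<in>I. mdist m y (\<beta> i) = mdist m x (\<alpha> i)"
proof -
  interpret Metric_space "mspace m" "mdist m"
    by simp
  obtain k where k: "\<And>n. k n \<in> I" "\<And>n. mdist m x (\<alpha> (k n)) < inverse (real (Suc n))"
  proof -
    have "\<exists>i\<in>I. mdist m x (\<alpha> i) < inverse (real (Suc n))" for n
      by (intro dense) simp
    then show thesis
      using that by metis
  qed
  have \<alpha>: "\<alpha> i \<in> mspace m" and \<beta>: "\<beta> i \<in> mspace m" if "i \<in> I" for i
    using that assms by auto
  have "(\<lambda>n. mdist m (\<alpha> (k n)) x) \<longlonglongrightarrow> 0"
  proof (rule tendsto_sandwich[OF _ _ tendsto_const LIMSEQ_inverse_real_of_nat])
    show "\<forall>\<^sub>F n in sequentially. mdist m (\<alpha> (k n)) x \<le> inverse (real (Suc n))"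
      using k(2) mdist_commute[of m x] by (intro always_eventually allI) (metis less_imp_le)
  qed simp
  then have lim_x: "limitin mtopology (\<lambda>n. \<alpha> (k n)) x sequentially"
    using x \<alpha> k by (simp add: limitin_metric_dist_null)
  then have "MCauchy (\<lambda>n. \<alpha> (k n))"
    using \<alpha> k by (intro convergent_imp_MCauchy) auto
  then have "MCauchy (\<lambda>n. \<beta> (k n))"
    using \<beta> k iso by (auto simp: MCauchy_def)
  then obtain y where lim_y: "limitin mtopology (\<lambda>n. \<beta> (k n)) y sequentially"
    using assms(1) unfolding mcomplete_of_def mcomplete_def by blast
  then have y: "y \<in> mspace m"
    by (simp add: limitin_mspace)
  have "mdist m y (\<beta> i) = mdist m x (\<alpha> i)" if i: "i \<in> I" for i
  proof (rule mdist_eq_by_approximation)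
    fix e :: real assume "e > 0"
    then have "\<forall>\<^sub>F n in sequentially. mdist m (\<alpha> (k n)) x < e \<and> mdist m (\<beta> (k n)) y < e"
      using lim_x lim_y by (auto simp: limitin_metric eventually_conj_iff elim: eventually_mono)
    then obtain n where "mdist m (\<alpha> (k n)) x < e" "mdist m (\<beta> (k n)) y < e"
      using eventually_sequentially by auto
    \<comment> \<open>The witnesses are the terms \<open>\<alpha> (k n)\<close> and
      \<open>\<beta> (k n)\<close> with a common late index.\<close>
    then show "\<exists>u\<in>mspace m. \<exists>u'\<in>mspace m. mdist m x u < e \<and> mdist m y u' < e \<and>
        mdist m u' (\<beta> i) = mdist m u (\<alpha> i)"
      using \<alpha> \<beta> k iso i by (metis mdist_commute)
  qed (use x y \<alpha> \<beta> i in auto)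
  then show ?thesis
    using y by blast
qed

text \<open>The value \<open>h x\<close> is a point whose distances to all
  \<open>\<iota> (g z)\<close> are those of \<open>x\<close> to \<open>\<iota> z\<close>. As
  \<open>g\<close> is onto, the points \<open>\<iota> (g z)\<close> are dense too, and the reverse
  transfer gives surjectivity.\<close>

lemma isometry_onto_extend_to_completion:
  assumes c: "is_completion m \<iota> m'" and g: "isometry_onto m m g"
  shows "\<exists>h. isometry_onto m' m' h \<and> (\<forall>z\<in>mspace m. h (\<iota> z) = \<iota> (g z))"
proof -
  have compl: "mcomplete_of m'"
    using c unfolding is_completion_def by blast
  have \<iota>: "\<iota> z \<in> mspace m'" and gM: "g z \<in> mspace m" and \<iota>g: "\<iota> (g z) \<in> mspace m'"
    if "z \<in> mspace m" for z
    using that is_completion_mspace[OF c] isometry_onto_mspace[OF g] by blast+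
  have \<iota>g_iso: "mdist m' (\<iota> (g z)) (\<iota> (g w)) = mdist m' (\<iota> z) (\<iota> w)"
    if "z \<in> mspace m" "w \<in> mspace m" for z w
    using that is_completion_mdist[OF c] isometry_onto_mdist[OF g] gM by simp
  note dense = is_completion_dense[OF c]
  have dense_g: "\<exists>z\<in>mspace m. mdist m' y (\<iota> (g z)) < e" if "y \<in> mspace m'" "e > 0" for y e
    using dense[OF that] isometry_onto_image[OF g] by (metis imageE)
  have "\<exists>y\<in>mspace m'. \<forall>z\<in>mspace m. mdist m' y (\<iota> (g z)) = mdist m' x (\<iota> z)"
    if "x \<in> mspace m'" for x
    using compl that dense \<iota> \<iota>g \<iota>g_iso by (intro mcomplete_transfer_point) auto
  then obtain h where hM: "\<And>x. x \<in> mspace m' \<Longrightarrow> h x \<in> mspace m'"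
    and h: "\<And>x z. \<lbrakk>x \<in> mspace m'; z \<in> mspace m\<rbrakk> \<Longrightarrow>
      mdist m' (h x) (\<iota> (g z)) = mdist m' x (\<iota> z)"
    by metis
  have h_iso: "mdist m' (h x) (h y) = mdist m' x y" if "x \<in> mspace m'" "y \<in> mspace m'" for x y
  proof (rule mdist_eq_by_approximation)
    fix e :: real assume "e > 0"
    then obtain z where "z \<in> mspace m" "mdist m' x (\<iota> z) < e"
      using dense \<open>x \<in> mspace m'\<close> by blast
    \<comment> \<open>If \<open>\<iota> z\<close> is close to \<open>x\<close>, then
      \<open>\<iota> (g z)\<close> is equally close to \<open>h x\<close>; these are the
      witnesses.\<close>
    then show "\<exists>u\<in>mspace m'. \<exists>u'\<in>mspace m'. mdist m' x u < e \<and> mdist m' (h x) u' < e \<and>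
        mdist m' u' (h y) = mdist m' u y"
      using h that \<iota> \<iota>g by (metis mdist_commute)
  qed (use that hM in auto)
  have "y \<in> h ` mspace m'" if y: "y \<in> mspace m'" for y
  proof -
    have "\<exists>x\<in>mspace m'. \<forall>z\<in>mspace m. mdist m' x (\<iota> z) = mdist m' y (\<iota> (g z))"
      using compl y dense_g \<iota> \<iota>g \<iota>g_iso by (intro mcomplete_transfer_point) auto
    then obtain x where x: "x \<in> mspace m'"
      and xy: "\<And>z. z \<in> mspace m \<Longrightarrow> mdist m' x (\<iota> z) = mdist m' y (\<iota> (g z))"
      by blast
    \<comment> \<open>This says that the distance is 0, in a form open to approximation: a point
      \<open>\<iota> (g z)\<close> near \<open>y\<close> is equally near \<open>h x\<close> and
      serves as both witnesses.\<close>
    have "mdist m' (h x) y = mdist m' y y"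
    proof (rule mdist_eq_by_approximation)
      fix e :: real assume "e > 0"
      then obtain z where "z \<in> mspace m" "mdist m' y (\<iota> (g z)) < e"
        using dense_g y by blast
      then show "\<exists>u\<in>mspace m'. \<exists>u'\<in>mspace m'. mdist m' y u < e \<and> mdist m' (h x) u' < e \<and>
          mdist m' u' y = mdist m' u y"
        using h[OF x] xy \<iota>g by metis
    qed (use x y hM in auto)
    then have "h x = y"
      using x y hM mdist_zero by metis
    then show ?thesis
      using x by blast
  qed
  then have "isometry_onto m' m' h"
    unfolding isometry_onto_def using h_iso hM by blast
  moreover have "h (\<iota> z) = \<iota> (g z)" if "z \<in> mspace m" for z
    using h[of "\<iota> z" z] \<iota> \<iota>g hM that mdist_zero by metis
  ultimately show ?thesis
    by blast
qed

lemma ultrametric_completion: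
  assumes c: "is_completion m \<iota> m'" and "ultrametric m"
  shows "ultrametric m'"
  unfolding ultrametric_def
proof (intro ballI, rule field_le_epsilon)
  fix x y z and e :: real
  assume M: "x \<in> mspace m'" "y \<in> mspace m'" "z \<in> mspace m'" and "e > 0"
  \<comment> \<open>Four errors add up to \<open>e\<close>: two in passing from \<open>x\<close>,
    \<open>z\<close> to \<open>u\<close>, \<open>w\<close>, and two in returning from the larger of
    the sides \<open>u v\<close> and \<open>v w\<close>.\<close>
  then have "e/4 > 0" by simp
  obtain u v w where u: "u \<in> mspace m" "mdist m' x (\<iota> u) < e/4"
    and v: "v \<in> mspace m" "mdist m' y (\<iota> v) < e/4"
    and w: "w \<in> mspace m" "mdist m' z (\<iota> w) < e/4"
    using is_completion_dense[OF c _ \<open>e/4 > 0\<close>] M by metis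
  note \<iota> = is_completion_mspace[OF c u(1)] is_completion_mspace[OF c v(1)]
    is_completion_mspace[OF c w(1)]
  have "mdist m' (\<iota> u) (\<iota> w) \<le> max (mdist m' (\<iota> u) (\<iota> v)) (mdist m' (\<iota> v) (\<iota> w))"
    using ultrametricD[OF assms(2) u(1) v(1) w(1)] is_completion_mdist[OF c] u v w by simp
  moreover have "mdist m' x z \<le> mdist m' x (\<iota> u) + mdist m' (\<iota> u) (\<iota> w) + mdist m' z (\<iota> w)"
    using mdist_triangle[of x m' "\<iota> u" z] mdist_triangle[of "\<iota> u" m' "\<iota> w" z]
      mdist_commute[of m' z "\<iota> w"] M \<iota> by simp
  moreover have "mdist m' (\<iota> u) (\<iota> v) \<le> mdist m' x (\<iota> u) + mdist m' x y + mdist m' y (\<iota> v)"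
    using mdist_triangle[of "\<iota> u" m' x "\<iota> v"] mdist_triangle[of x m' y "\<iota> v"]
      mdist_commute[of m' x "\<iota> u"] M \<iota> by simp
  moreover have "mdist m' (\<iota> v) (\<iota> w) \<le> mdist m' y (\<iota> v) + mdist m' y z + mdist m' z (\<iota> w)"
    using mdist_triangle[of "\<iota> v" m' y "\<iota> w"] mdist_triangle[of y m' z "\<iota> w"]
      mdist_commute[of m' y "\<iota> v"] M \<iota> by simp
  ultimately show "mdist m' x z \<le> max (mdist m' x y) (mdist m' y z) + e"
    using u v w by linarith
qed

section \<open>Approximate extensions in the completion\<close>

lemma ultrametric_perturb:
  assumes um: "ultrametric m" and "a \<in> mspace m" "b \<in> mspace m" "a' \<in> mspace m" "b' \<in> mspace m"
    and "mdist m a a' < mdist m a b" "mdist m b b' < mdist m a b"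
  shows "mdist m a' b' = mdist m a b"
proof -
  have "mdist m a' b = mdist m a b"
    using assms by (intro ultrametric_isosceles) (auto simp: mdist_commute)
  moreover have "mdist m b' a' = mdist m b a'"
    using assms calculation by (intro ultrametric_isosceles) (auto simp: mdist_commute)
  ultimately show ?thesis
    by (simp add: mdist_commute)
qed

text \<open>The points of \<open>A\<close> and their images are rounded to points of
  \<open>m\<close>. Homogeneity extends the rounded map to an isometry of \<open>m\<close>, which
  then extends to \<open>m'\<close>. The rounding errors at \<open>a\<close> and at
  \<open>f a\<close> do not add up, by the ultrametric inequality.\<close>

lemma approximate_extension_in_completion:
  assumes um: "ultrametric m'" and hom: "homogeneous m" and c: "is_completion m \<iota> m'"
    and fin: "finite A" and A: "A \<subseteq> mspace m'" and fA: "f ` A \<subseteq> mspace m'"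
    and fiso: "\<And>a b. \<lbrakk>a \<in> A; b \<in> A\<rbrakk> \<Longrightarrow> mdist m' (f a) (f b) = mdist m' a b"
    and "e > 0"
  shows "\<exists>h. isometry_onto m' m' h \<and> (\<forall>a\<in>A. mdist m' (h a) (f a) < e)"
proof -
  \<comment> \<open>Including \<open>e\<close> ensures \<open>\<delta> \<le> e\<close> and keeps
    \<open>S\<close> nonempty when \<open>A\<close> has at most one point.\<close>
  define S where "S = insert e ((\<lambda>(a, b). mdist m' a b) ` {(a, b) \<in> A \<times> A. a \<noteq> b})"
  define \<delta> where "\<delta> = Min S"
  have "finite {(a, b) \<in> A \<times> A. a \<noteq> b}"
    using fin by (auto intro: finite_subset[of _ "A \<times> A"])
  then have finS: "finite S"
    by (simp add: S_def)
  have "\<forall>s\<in>S. s > 0"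
    using A \<open>e > 0\<close> by (auto simp: S_def subset_iff
        intro: Metric_space.mdist_pos_less[OF Metric_space_mspace_mdist])
  then have "\<delta> > 0"
    unfolding \<delta>_def using finS by (auto simp: S_def)
  have "\<delta> \<le> e"
    unfolding \<delta>_def using finS by (intro Min_le) (auto simp: S_def)
  have \<delta>_le: "\<delta> \<le> mdist m' a b" if "a \<in> A" "b \<in> A" "a \<noteq> b" for a b
    unfolding \<delta>_def using finS that by (intro Min_le) (auto simp: S_def)
  have "\<forall>x\<in>mspace m'. \<exists>z\<in>mspace m. mdist m' x (\<iota> z) < \<delta>"
    using is_completion_dense[OF c _ \<open>\<delta> > 0\<close>] by blast
  then obtain p where p: "\<And>x. x \<in> mspace m' \<Longrightarrow> p x \<in> mspace m"
    and p_close: "\<And>x. x \<in> mspace m' \<Longrightarrow> mdist m' x (\<iota> (p x)) < \<delta>"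
    by metis
  note \<iota> = is_completion_mspace[OF c] and \<iota>_iso = is_completion_mdist[OF c]
  have p_iso: "mdist m (p x) (p y) = mdist m' x y"
    if "x \<in> mspace m'" "y \<in> mspace m'" "\<delta> \<le> mdist m' x y" for x y
  proof -
    have "mdist m' (\<iota> (p x)) (\<iota> (p y)) = mdist m' x y"
      using that p p_close[of x] p_close[of y] \<iota> um by (intro ultrametric_perturb) auto
    then show ?thesis
      using \<iota>_iso p that by simp
  qed
  have AM: "a \<in> mspace m'" and fM: "f a \<in> mspace m'" if "a \<in> A" for a
    using that A fA by auto
  \<comment> \<open>The bound by \<open>\<delta>\<close> is available for distinct points only; it
    holds for \<open>f a\<close> and \<open>f b\<close> as well because \<open>f\<close> keeps
    distances.\<close>
  have pA: "mdist m (p (f a)) (p (f b)) = mdist m (p a) (p b)" if "a \<in> A" "b \<in> A" for a b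
  proof (cases "a = b")
    case True
    then show ?thesis using mdist_refl AM fM p that by metis
  next
    case False
    then show ?thesis
      using that p_iso AM fM \<delta>_le fiso by simp
  qed
  \<comment> \<open>Rounding keeps distinct points of \<open>A\<close> at least
    \<open>\<delta>\<close> apart, so \<open>F\<close> below can undo it.\<close>
  have "inj_on p A"
  proof (rule inj_onI, rule ccontr)
    fix a b assume ab: "a \<in> A" "b \<in> A" "p a = p b" "a \<noteq> b"
    then have "mdist m (p a) (p b) \<ge> \<delta>"
      using p_iso[of a b] AM \<delta>_le[of a b] by metis
    then show False
      using ab \<open>\<delta> > 0\<close> p AM mdist_refl[of "p b" m] by simp
  qed
  define F where "F = p \<circ> f \<circ> inv_into A p"
  have F: "F (p a) = p (f a)" if "a \<in> A" for a
    using that \<open>inj_on p A\<close> by (simp add: F_def)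
  have sub: "p ` A \<subseteq> mspace m" "p ` f ` A \<subseteq> mspace m"
    using p AM fM by auto
  have "isometry_onto (submetric m (p ` A)) (submetric m (p ` f ` A)) F"
    unfolding isometry_onto_submetric[OF sub] using F pA by (auto simp: image_image)
  then obtain g where g: "isometry_onto m m g" and gF: "\<forall>x\<in>p ` A. g x = F x"
    using hom sub fin unfolding homogeneous_def by (meson finite_imageI)
  obtain h where h: "isometry_onto m' m' h" and hg: "\<forall>z\<in>mspace m. h (\<iota> z) = \<iota> (g z)"
    using isometry_onto_extend_to_completion[OF c g] by blast
  have "mdist m' (h a) (f a) < e" if a: "a \<in> A" for a
  proof -
    have eq: "h (\<iota> (p a)) = \<iota> (p (f a))"
      using hg gF F a p AM by simp
    \<comment> \<open>The isometry \<open>h\<close> carries the rounding error at \<open>a\<close>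
      over to its image: \<open>h a\<close> and \<open>f a\<close> are both within
      \<open>\<delta>\<close> of \<open>\<iota> (p (f a))\<close>.\<close>
    have "mdist m' (h a) (\<iota> (p (f a))) = mdist m' a (\<iota> (p a))"
      using isometry_onto_mdist[OF h, of a "\<iota> (p a)"] eq a AM p \<iota> by simp
    moreover have "mdist m' (h a) (f a) \<le>
        max (mdist m' (h a) (\<iota> (p (f a)))) (mdist m' (\<iota> (p (f a))) (f a))"
      using isometry_onto_mspace[OF h] a AM fM p \<iota> by (intro ultrametricD[OF um]) auto
    ultimately show ?thesis
      using p_close[OF AM[OF a]] p_close[OF fM[OF a]] \<open>\<delta> \<le> e\<close>
        mdist_commute[of m' "f a" "\<iota> (p (f a))"] by linarith
  qed
  with h show ?thesis
    by blast
qed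

theorem theorem11:
  fixes m :: "'a metric" and \<iota> :: "'a \<Rightarrow> 'b" and m' :: "'b metric"
  assumes "ultrametric m"
    and "homogeneous m"
    and "is_completion m \<iota> m'"
  shows "homogeneous m'"
  unfolding homogeneous_def
proof (intro allI impI)
  fix A B f
  assume *: "finite A \<and> A \<subseteq> mspace m' \<and> finite B \<and> B \<subseteq> mspace m' \<and>
    isometry_onto (submetric m' A) (submetric m' B) f"
  then have f: "f ` A = B" "\<forall>x\<in>A. \<forall>y\<in>A. mdist m' (f x) (f y) = mdist m' x y"
    using isometry_onto_submetric[of A m' B f] by auto
  have um: "ultrametric m'"
    using ultrametric_completion assms by blast
  show "\<exists>g. isometry_onto m' m' g \<and> (\<forall>x\<in>A. g x = f x)"
    using * f by (intro ultrametric_isometry_of_approximations[OF um]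
        approximate_extension_in_completion[OF um assms(2,3)]) auto
qed

end
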